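(* Assume that $\rho_0\in\mathbb{C}^{m\times m}$ satisfies $\mathrm{Tr}(\rho_0)=1$. Then, for any time step size $\tau>0$, the full-rank exponential Euler scheme $$\rho_{n+1}=e^{\tau A}\rho_n e^{\tau A^{\dagger}}+\sum_{k=1}^K\gamma_k\int_0^{\tau}L_k e^{sA}\rho_n e^{sA^{\dagger}}L_k^{\dagger}\,ds,\qquad n\ge 0,$$ preserves unit trace in the sense that $\mathrm{Tr}(\rho_n)=1$ for all $n\ge 0$.
   Context: $m,K$ are positive integers; $H\in\mathbb{C}^{m\times m}$ is Hermitian; $L_1,\dots,L_K\in\mathbb{C}^{m\times m}$ are arbitrary matrices; $\gamma_1,\dots,\gamma_K\ge 0$ are real. The superscript $\dagger$ denotes the conjugate transpose and $\mathrm{Tr}$ the trace. The matrix $A$ is $$A=-iH-\frac12\sum_{k=1}^K\gamma_k L_k^{\dagger}L_k .$$ *)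

theory Defs
  imports "HOL-Analysis.Analysis"
begin

text \<open>
  An element of \<^typ>\<open>complex^'m^'m\<close> is an \<open>m\<close>-by-\<open>m\<close> complex matrix, with \<open>m = CARD('m) \<ge> 1\<close>.
\<close>

definition conj_transpose :: "complex^'n^'m \<Rightarrow> complex^'m^'n" where
  "conj_transpose M = (\<chi> i j. cnj (M $ j $ i))"

definition hermitian :: "complex^'m^'m \<Rightarrow> bool" where
  "hermitian M \<longleftrightarrow> conj_transpose M = M"

text \<open>
  The library's power operation on \<^typ>\<open>complex^'m^'m\<close> is entrywise, and this type is not an
  instance of the class in which \<^const>\<open>exp\<close> is defined. So the powers with respect to the matrix
  product, and the exponential series built from them, are introduced here.
\<close>

primrec matrix_pow :: "complex^'m^'m \<Rightarrow> nat \<Rightarrow> complex^'m^'m" where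
  "matrix_pow M 0 = mat 1"
| "matrix_pow M (Suc k) = M ** matrix_pow M k"

definition matrix_exp :: "complex^'m^'m \<Rightarrow> complex^'m^'m" where
  "matrix_exp M = (\<Sum>k. (1 / fact k) *\<^sub>R matrix_pow M k)"

definition drift ::
  "nat \<Rightarrow> complex^'m^'m \<Rightarrow> (nat \<Rightarrow> complex^'m^'m) \<Rightarrow> (nat \<Rightarrow> real) \<Rightarrow> complex^'m^'m" where
  "drift K H L \<gamma> =
     (\<chi> i j. - \<i> * H $ i $ j)
     - (1 / 2) *\<^sub>R (\<Sum>k = 1..K. \<gamma> k *\<^sub>R (conj_transpose (L k) ** L k))"

definition exp_euler_step ::
  "nat \<Rightarrow> complex^'m^'m \<Rightarrow> (nat \<Rightarrow> complex^'m^'m) \<Rightarrow> (nat \<Rightarrow> real) \<Rightarrow> real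
     \<Rightarrow> complex^'m^'m \<Rightarrow> complex^'m^'m" where
  "exp_euler_step K H L \<gamma> \<tau> \<rho> =
     (let A = drift K H L \<gamma> in
        matrix_exp (\<tau> *\<^sub>R A) ** \<rho> ** matrix_exp (\<tau> *\<^sub>R conj_transpose A)
        + (\<Sum>k = 1..K. \<gamma> k *\<^sub>R
             integral {0..\<tau>}
               (\<lambda>s. L k ** matrix_exp (s *\<^sub>R A) ** \<rho> ** matrix_exp (s *\<^sub>R conj_transpose A)
                    ** conj_transpose (L k))))"

end

theory Submission
  imports Defs
begin

text \<open>
  Let \<open>G s = e\<^bsup>sA\<^esup> \<rho> e\<^bsup>sA\<^sup>\<dagger>\<^esup>\<close>. Its derivative is \<open>A G + G A\<^sup>\<dagger>\<close>, whose trace is \<open>Tr ((A + A\<^sup>\<dagger>) G)\<close> by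
  cyclicity. The Hamiltonian part of \<open>A\<close> is skew-Hermitian, so it drops out of
  \<open>A + A\<^sup>\<dagger> = - \<Sum>\<^sub>k \<gamma>\<^sub>k L\<^sub>k\<^sup>\<dagger> L\<^sub>k\<close>, and cyclicity again gives
  \<open>d/ds Tr (G s) = - \<Sum>\<^sub>k \<gamma>\<^sub>k Tr (L\<^sub>k G s L\<^sub>k\<^sup>\<dagger>)\<close>. Integrated over \<open>[0, \<tau>]\<close>, this says that the trace lost by
  the first term of the scheme is exactly the trace of the integral terms. So one step preserves the
  trace of an arbitrary matrix (\<open>trace_exp_euler_step\<close>), and the theorem follows by induction.

  The analytic input is the derivative of \<open>s \<mapsto> e\<^bsup>sA\<^esup>\<close>. It is obtained from the termwise
  differentiation of real power series, applied to each coordinate of the exponential series.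
\<close>

section \<open>Exponential series in Euclidean spaces\<close>

lemma summable_exp_series:
  fixes a :: "nat \<Rightarrow> 'a::banach"
  assumes bound: "\<And>k. norm (a k) \<le> C * r ^ k"
  shows "summable (\<lambda>k. (s ^ k / fact k) *\<^sub>R a k)"
proof (rule summable_comparison_test')
  have "summable (\<lambda>k. C * (inverse (fact k) * (\<bar>s\<bar> * r) ^ k))"
    by (intro summable_mult summable_exp)
  then show "summable (\<lambda>k. C * ((\<bar>s\<bar> * r) ^ k / fact k))"
    by (simp add: field_simps)
  show "norm ((s ^ k / fact k) *\<^sub>R a k) \<le> C * ((\<bar>s\<bar> * r) ^ k / fact k)" for k
    using mult_left_mono[OF bound[of k], of "\<bar>s\<bar> ^ k / fact k"]
    by (simp add: power_abs power_mult_distrib field_simps)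
qed

text \<open>
  Differentiation shifts the coefficients by one index. Pairing with a basis vector reduces this to
  a real power series; the growth bound makes both series converge, so that the pairing can be
  exchanged with the summation.
\<close>

lemma exp_series_has_vector_derivative:
  fixes a :: "nat \<Rightarrow> 'a::euclidean_space"
  assumes bound: "\<And>k. norm (a k) \<le> C * r ^ k"
  shows "((\<lambda>s. \<Sum>k. (s ^ k / fact k) *\<^sub>R a k) has_vector_derivative
            (\<Sum>k. (s ^ k / fact k) *\<^sub>R a (Suc k))) (at s within S)"
proof -
  have sums: "summable (\<lambda>k. (x ^ k / fact k) *\<^sub>R a k)" for x
    by (rule summable_exp_series[OF bound])
  have "norm (a (Suc k)) \<le> (C * r) * r ^ k" for k
    using bound[of "Suc k"] by (simp add: mult_ac)
  then have sums': "summable (\<lambda>k. (x ^ k / fact k) *\<^sub>R a (Suc k))" for x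
    by (rule summable_exp_series)
  have "((\<lambda>s. (\<Sum>k. (s ^ k / fact k) *\<^sub>R a k) \<bullet> b) has_real_derivative
            (\<Sum>k. (s ^ k / fact k) *\<^sub>R a (Suc k)) \<bullet> b) (at s within S)" for b
  proof -
    define c where "c k = (a k \<bullet> b) / fact k" for k
    have pair: "(x ^ k / fact k) *\<^sub>R a k \<bullet> b = c k * x ^ k" for x k
      by (simp add: c_def)
    have pair': "(x ^ k / fact k) *\<^sub>R a (Suc k) \<bullet> b = diffs c k * x ^ k" for x k
      by (simp add: c_def diffs_def del: of_nat_Suc)
    have series: "(\<Sum>k. (x ^ k / fact k) *\<^sub>R a k) \<bullet> b = (\<Sum>k. c k * x ^ k)" for x
      using bounded_linear.suminf[OF bounded_linear_inner_left[of b] sums[of x]] by (simp only: pair)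
    have series': "(\<Sum>k. (s ^ k / fact k) *\<^sub>R a (Suc k)) \<bullet> b = (\<Sum>k. diffs c k * s ^ k)"
      using bounded_linear.suminf[OF bounded_linear_inner_left[of b] sums'[of s]] by (simp only: pair')
    have "summable (\<lambda>k. c k * x ^ k)" for x
      using bounded_linear.summable[OF bounded_linear_inner_left[of b] sums[of x]] by (simp only: pair)
    then have "((\<lambda>x. \<Sum>k. c k * x ^ k) has_real_derivative (\<Sum>k. diffs c k * s ^ k)) (at s)"
      by (rule termdiffs_strong_converges_everywhere)
    then show ?thesis
      unfolding series series' by (rule has_field_derivative_at_within)
  qed
  then show ?thesis
    unfolding has_vector_derivative_def
    by (subst has_derivative_componentwise_within)
       (simp add: has_field_derivative_def mult.commute[of _ "inner _ _"])
qed

section \<open>Bilinear matrix algebra over the reals\<close>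

lemma matrix_mul_scaleR_left:
  fixes M :: "complex^'n^'m" and N :: "complex^'p^'n"
  shows "(c *\<^sub>R M) ** N = c *\<^sub>R (M ** N)"
  by (simp add: matrix_matrix_mult_def vec_eq_iff scaleR_sum_right)

lemma matrix_mul_scaleR_right:
  fixes M :: "complex^'n^'m" and N :: "complex^'p^'n"
  shows "M ** (c *\<^sub>R N) = c *\<^sub>R (M ** N)"
  by (simp add: matrix_matrix_mult_def vec_eq_iff scaleR_sum_right)

lemma matrix_add_rdistrib:
  fixes M N :: "complex^'n^'m" and P :: "complex^'p^'n"
  shows "(M + N) ** P = M ** P + N ** P"
  by (simp add: matrix_matrix_mult_def vec_eq_iff sum.distrib distrib_right)

text \<open>
  In finite dimension bilinearity already gives boundedness. This supplies the product rule, the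
  continuity of products, and a submultiplicative norm bound up to a constant.
\<close>

lemma bounded_bilinear_matrix_mul:
  "bounded_bilinear ((**) :: complex^'n^'m \<Rightarrow> complex^'p^'n \<Rightarrow> complex^'p^'m)"
  unfolding bilinear_conv_bounded_bilinear[symmetric] bilinear_def
  by (auto intro!: linearI simp: matrix_add_ldistrib matrix_add_rdistrib
        matrix_mul_scaleR_left matrix_mul_scaleR_right)

lemmas bounded_linear_matrix_mul_left =
  bounded_bilinear.bounded_linear_left[OF bounded_bilinear_matrix_mul]

lemmas bounded_linear_matrix_mul_right =
  bounded_bilinear.bounded_linear_right[OF bounded_bilinear_matrix_mul]

lemma bounded_linear_trace: "bounded_linear (trace :: complex^'m^'m \<Rightarrow> complex)"
  unfolding linear_conv_bounded_linear[symmetric]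
  by (auto intro!: linearI simp: trace_add) (simp add: trace_def scaleR_sum_right)

lemmas trace_scaleR = linear_cmul[OF bounded_linear.linear[OF bounded_linear_trace]]
lemmas trace_sum = linear_sum[OF bounded_linear.linear[OF bounded_linear_trace]]

lemma linear_conj_transpose: "linear (conj_transpose :: complex^'n^'m \<Rightarrow> complex^'m^'n)"
  by (auto intro!: linearI simp: conj_transpose_def vec_eq_iff)

lemma conj_transpose_mul: "conj_transpose (M ** N) = conj_transpose N ** conj_transpose M"
  by (simp add: conj_transpose_def matrix_matrix_mult_def vec_eq_iff mult.commute)

lemma conj_transpose_conj_transpose [simp]: "conj_transpose (conj_transpose M) = M"
  by (simp add: conj_transpose_def vec_eq_iff)

section \<open>The matrix exponential along a line\<close>

lemma matrix_pow_scaleR: "matrix_pow (s *\<^sub>R M) k = s ^ k *\<^sub>R matrix_pow M k"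
  by (induction k) (simp_all add: matrix_mul_scaleR_left matrix_mul_scaleR_right)

lemma matrix_pow_commute: "matrix_pow M k ** M = M ** matrix_pow M k"
  by (induction k) (simp_all add: matrix_mul_assoc[symmetric])

lemma matrix_pow_norm_bound:
  fixes M :: "complex^'m^'m"
  obtains C r where "\<And>k. norm (matrix_pow M k) \<le> C * r ^ k"
proof -
  obtain B where B: "B > 0"
    "\<And>N P. norm ((N :: complex^'m^'m) ** (P :: complex^'m^'m)) \<le> norm N * norm P * B"
    using bounded_bilinear.pos_bounded[OF bounded_bilinear_matrix_mul] by blast
  have "norm (matrix_pow M k) \<le> norm (mat 1 :: complex^'m^'m) * (norm M * B) ^ k" for k
  proof (induction k)
    case (Suc k)
    have "norm (matrix_pow M (Suc k)) \<le> norm M * B * norm (matrix_pow M k)"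
      using B(2)[of M "matrix_pow M k"] by (simp add: mult_ac)
    also have "\<dots> \<le> norm M * B * (norm (mat 1 :: complex^'m^'m) * (norm M * B) ^ k)"
      using B(1) by (intro mult_left_mono Suc.IH) simp
    finally show ?case
      by (simp add: mult_ac)
  qed simp
  then show thesis
    by (rule that)
qed

lemma matrix_exp_scaleR: "matrix_exp (s *\<^sub>R M) = (\<Sum>k. (s ^ k / fact k) *\<^sub>R matrix_pow M k)"
  by (simp add: matrix_exp_def matrix_pow_scaleR)

lemma summable_matrix_exp: "summable (\<lambda>k. (s ^ k / fact k) *\<^sub>R matrix_pow M k)"
  by (metis matrix_pow_norm_bound summable_exp_series)

lemma matrix_exp_0 [simp]: "matrix_exp 0 = mat 1"
proof -
  have "matrix_exp (0 :: complex^'m^'m) = (\<Sum>k. (0 ^ k / fact k) *\<^sub>R matrix_pow 0 k)"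
    using matrix_exp_scaleR[of 0 0] by simp
  also have "\<dots> = (\<Sum>k\<in>{0}. (0 ^ k / fact k) *\<^sub>R matrix_pow 0 k)"
    by (rule suminf_finite) auto
  finally show ?thesis
    by simp
qed

lemma matrix_exp_commute: "matrix_exp (s *\<^sub>R M) ** M = M ** matrix_exp (s *\<^sub>R M)"
  unfolding matrix_exp_scaleR
    bounded_linear.suminf[OF bounded_linear_matrix_mul_left summable_matrix_exp]
    bounded_linear.suminf[OF bounded_linear_matrix_mul_right summable_matrix_exp]
  by (simp add: matrix_mul_scaleR_left matrix_mul_scaleR_right matrix_pow_commute)

lemma matrix_exp_has_vector_derivative:
  "((\<lambda>s. matrix_exp (s *\<^sub>R M)) has_vector_derivative M ** matrix_exp (s *\<^sub>R M)) (at s within S)"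
proof -
  obtain C r where bound: "\<And>k. norm (matrix_pow M k) \<le> C * r ^ k"
    by (rule matrix_pow_norm_bound) blast
  have "(\<Sum>k. (s ^ k / fact k) *\<^sub>R matrix_pow M (Suc k)) = M ** matrix_exp (s *\<^sub>R M)"
    unfolding matrix_exp_scaleR
      bounded_linear.suminf[OF bounded_linear_matrix_mul_right summable_matrix_exp]
    by (simp add: matrix_mul_scaleR_right)
  then show ?thesis
    using exp_series_has_vector_derivative[where a = "matrix_pow M", OF bound, of s S]
    by (simp add: matrix_exp_scaleR)
qed

text \<open>
  The product rule produces \<open>B e\<^bsup>sB\<^esup>\<close> from the right factor. Commuting \<open>B\<close> past its own exponential
  moves it to the outside, where cyclicity of the trace can reach it.
\<close>

lemma matrix_exp_sandwich_has_vector_derivative: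
  fixes A B \<rho> :: "complex^'m^'m"
  defines "G \<equiv> \<lambda>s. matrix_exp (s *\<^sub>R A) ** \<rho> ** matrix_exp (s *\<^sub>R B)"
  shows "(G has_vector_derivative A ** G s + G s ** B) (at s within S)"
proof -
  have "((\<lambda>s. matrix_exp (s *\<^sub>R A) ** \<rho>) has_vector_derivative A ** matrix_exp (s *\<^sub>R A) ** \<rho>)
          (at s within S)"
    by (rule bounded_linear.has_vector_derivative
        [OF bounded_linear_matrix_mul_left matrix_exp_has_vector_derivative])
  from bounded_bilinear.has_vector_derivative
    [OF bounded_bilinear_matrix_mul this matrix_exp_has_vector_derivative[of B]]
  show ?thesis
    unfolding G_def by (simp add: matrix_exp_commute[symmetric] matrix_mul_assoc add.commute)
qed

section \<open>Trace balance of one step\<close>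

text \<open>
  The term \<open>-iH\<close> is skew-Hermitian and cancels, while each \<open>L\<^sub>k\<^sup>\<dagger> L\<^sub>k\<close> is Hermitian, so the two halves of
  the dissipative term add up. This is where the factor \<open>1/2\<close> in the drift is used.
\<close>

lemma drift_add_conj_transpose:
  assumes "hermitian H"
  shows "drift K H L \<gamma> + conj_transpose (drift K H L \<gamma>)
           = - (\<Sum>k = 1..K. \<gamma> k *\<^sub>R (conj_transpose (L k) ** L k))"
proof -
  define D where "D = (\<Sum>k = 1..K. \<gamma> k *\<^sub>R (conj_transpose (L k) ** L k))"
  define J where "J = (\<chi> i j. - \<i> * H $ i $ j)"
  have H: "cnj (H $ i $ j) = H $ j $ i" for i j
    using assms by (auto simp: hermitian_def conj_transpose_def vec_eq_iff)
  have J: "conj_transpose J = - J"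
    by (simp add: J_def conj_transpose_def vec_eq_iff H)
  have D: "conj_transpose D = D"
    by (simp add: D_def linear_sum[OF linear_conj_transpose] linear_cmul[OF linear_conj_transpose]
        conj_transpose_mul)
  have "drift K H L \<gamma> = J - (1 / 2) *\<^sub>R D"
    by (simp add: drift_def J_def D_def)
  moreover have "conj_transpose (J - (1 / 2) *\<^sub>R D) = - J - (1 / 2) *\<^sub>R D"
    by (simp only: linear_diff[OF linear_conj_transpose] linear_cmul[OF linear_conj_transpose] J D)
  ultimately show ?thesis
    unfolding D_def[symmetric] by (simp flip: diff_diff_eq scaleR_left_distrib)
qed

text \<open>
  The infinitesimal form of the trace balance: the generator \<open>X \<mapsto> A X + X A\<^sup>\<dagger> + \<Sum>\<^sub>k \<gamma>\<^sub>k L\<^sub>k X L\<^sub>k\<^sup>\<dagger>\<close> of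
  the Lindblad equation has traceless values.
\<close>

lemma trace_drift_balance:
  assumes "hermitian H"
  shows "trace (drift K H L \<gamma> ** X + X ** conj_transpose (drift K H L \<gamma>))
           = - (\<Sum>k = 1..K. \<gamma> k *\<^sub>R trace (L k ** X ** conj_transpose (L k)))"
proof -
  define A where "A = drift K H L \<gamma>"
  have "trace (A ** X + X ** conj_transpose A) = trace ((A + conj_transpose A) ** X)"
    by (simp add: trace_add matrix_add_rdistrib trace_mul_sym[of X])
  also have "\<dots> = - trace ((\<Sum>k = 1..K. \<gamma> k *\<^sub>R (conj_transpose (L k) ** L k)) ** X)"
    unfolding A_def drift_add_conj_transpose[OF assms]
    by (simp add: bounded_bilinear.minus_left[OF bounded_bilinear_matrix_mul]
        linear_neg[OF bounded_linear.linear[OF bounded_linear_trace]])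
  also have "\<dots> = - (\<Sum>k = 1..K. \<gamma> k *\<^sub>R trace (conj_transpose (L k) ** (L k ** X)))"
    by (simp add: bounded_bilinear.sum_left[OF bounded_bilinear_matrix_mul] trace_sum trace_scaleR
        matrix_mul_scaleR_left matrix_mul_assoc)
  finally show ?thesis
    unfolding A_def by (subst (asm) trace_mul_sym)
qed

text \<open>
  The trace of the integral terms is the integral of \<open>- d/ds Tr (G s)\<close>, where \<open>G s\<close> is the evolved
  matrix inside the integral; the fundamental theorem of calculus turns it into
  \<open>Tr (G 0) - Tr (G \<tau>)\<close>, and \<open>G \<tau>\<close> is the first term of the scheme.
\<close>

lemma trace_exp_euler_step:
  assumes "hermitian H" and "\<tau> \<ge> 0"
  shows "trace (exp_euler_step K H L \<gamma> \<tau> \<rho>) = trace \<rho>"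
proof -
  define A where "A = drift K H L \<gamma>"
  define G where "G s = matrix_exp (s *\<^sub>R A) ** \<rho> ** matrix_exp (s *\<^sub>R conj_transpose A)" for s
  define F where "F k s = L k ** G s ** conj_transpose (L k)" for k s
  have deriv: "(G has_vector_derivative A ** G s + G s ** conj_transpose A) (at s within S)" for s S
    using matrix_exp_sandwich_has_vector_derivative[of A \<rho> "conj_transpose A" s S]
    by (simp add: G_def[abs_def])
  have "continuous_on {0..\<tau>} G"
    using deriv by (rule continuous_on_vector_derivative)
  then have "(F k) integrable_on {0..\<tau>}" for k
    unfolding F_def
    by (intro integrable_continuous_real bounded_bilinear.continuous_on[OF bounded_bilinear_matrix_mul]
        continuous_on_const)
  then have int_F: "((\<lambda>s. trace (F k s)) has_integral trace (integral {0..\<tau>} (F k))) {0..\<tau>}" for k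
    using has_integral_linear[OF integrable_integral bounded_linear_trace, of "F k"] by (simp add: o_def)
  have "((\<lambda>s. trace (G s)) has_vector_derivative - (\<Sum>k = 1..K. \<gamma> k *\<^sub>R trace (F k s)))
          (at s within {0..\<tau>})" for s
    using bounded_linear.has_vector_derivative[OF bounded_linear_trace deriv]
    unfolding A_def trace_drift_balance[OF assms(1)] F_def .
  then have "((\<lambda>s. - (\<Sum>k = 1..K. \<gamma> k *\<^sub>R trace (F k s))) has_integral trace (G \<tau>) - trace (G 0)) {0..\<tau>}"
    using assms(2) by (intro fundamental_theorem_of_calculus) auto
  moreover have "((\<lambda>s. - (\<Sum>k = 1..K. \<gamma> k *\<^sub>R trace (F k s))) has_integral
      - (\<Sum>k = 1..K. \<gamma> k *\<^sub>R trace (integral {0..\<tau>} (F k)))) {0..\<tau>}"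
    by (intro has_integral_neg has_integral_sum has_integral_cmul int_F) simp
  ultimately have "trace (G \<tau>) - trace (G 0) = - (\<Sum>k = 1..K. \<gamma> k *\<^sub>R trace (integral {0..\<tau>} (F k)))"
    by (rule has_integral_unique)
  moreover have "exp_euler_step K H L \<gamma> \<tau> \<rho> = G \<tau> + (\<Sum>k = 1..K. \<gamma> k *\<^sub>R integral {0..\<tau>} (F k))"
    by (simp add: exp_euler_step_def Let_def A_def G_def F_def[abs_def] matrix_mul_assoc)
  moreover have "G 0 = \<rho>"
    by (simp add: G_def)
  ultimately show ?thesis
    by (simp add: trace_add trace_sum trace_scaleR algebra_simps)
qed

theorem theorem3p3:
  fixes H :: "complex^'m^'m"
    and L :: "nat \<Rightarrow> complex^'m^'m"
    and \<gamma> :: "nat \<Rightarrow> real"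
    and K :: nat
    and \<tau> :: real
    and \<rho> :: "nat \<Rightarrow> complex^'m^'m"
  assumes "K \<ge> 1"
    and "hermitian H"
    and "\<And>k. k \<in> {1..K} \<Longrightarrow> \<gamma> k \<ge> 0"
    and "trace (\<rho> 0) = 1"
    and "\<tau> > 0"
    and "\<And>n. \<rho> (Suc n) = exp_euler_step K H L \<gamma> \<tau> (\<rho> n)"
  shows "\<forall>n. trace (\<rho> n) = 1"
proof
  show "trace (\<rho> n) = 1" for n
    by (induction n) (use assms in \<open>simp_all add: trace_exp_euler_step\<close>)
qed

end
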